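(* For $p:=p(n)$ with $1/n\le p\le 1/2$ and every $\delta\in(0,4/7)$, with high probability, \[ \operatorname{tww}(G(n,p))\ge(1-\delta)np-\frac{4(1-\delta)}{\delta}. \]
   Context: $G(n,p)$ is the random graph on vertex set $\{1,\ldots,n\}$ in which each unordered pair of distinct vertices is adjacent with probability $p$, independently; here $p$ may depend on $n$, while $\delta$ is a constant. "With high probability" means with probability tending to $1$ as $n\to\infty$. All graphs are finite and simple. Twin-width. A trigraph is a triple $G=(V,B,R)$ where $B,R$ are disjoint sets of $2$-element subsets of the finite set $V$; elements of $B$ are black edges and elements of $R$ are red edges. A graph $(V,E)$ is identified with the trigraph $(V,E,\emptyset)$. The red-degree of a vertex is the number of red edges incident with it. For distinct vertices $u,v$ (not necessarily adjacent), contracting $u$ and $v$ yields the trigraph obtained by deleting $u,v$, adding a new vertex $w$, keeping all edges (with colors) among the other vertices, and for each other vertex $x$: $wx$ is a black edge if both $ux$ and $vx$ are black edges; $wx$ is a non-edge if both $ux$ and $vx$ are non-edges; and $wx$ is a red edge otherwise. A $d$-contraction sequence of $G$ is a sequence of trigraphs starting with $G$, ending with a $1$-vertex graph, each obtained from the previous one by contracting two vertices, in which all trigraphs have maximum red-degree at most $d$. The twin-width $\operatorname{tww}(G)$ is the minimum $d$ such that $G$ has a $d$-contraction sequence. *)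

theory Defs
  imports "HOL-Probability.Probability" "HOL-Library.Infinite_Typeclass"
begin

record 'a trigraph =
  verts :: "'a set"
  black :: "'a set set"
  red :: "'a set set"

definition all_pairs :: "'a set \<Rightarrow> 'a set set" where
  "all_pairs V = {e. e \<subseteq> V \<and> card e = 2}"

definition is_trigraph :: "'a trigraph \<Rightarrow> bool" where
  "is_trigraph G \<longleftrightarrow> finite (verts G) \<and> black G \<subseteq> all_pairs (verts G)
     \<and> red G \<subseteq> all_pairs (verts G) \<and> black G \<inter> red G = {}"

definition trigraph_of_graph :: "'a set \<Rightarrow> 'a set set \<Rightarrow> 'a trigraph" where
  "trigraph_of_graph V E = \<lparr>verts = V, black = E, red = {}\<rparr>"

definition red_degree :: "'a trigraph \<Rightarrow> 'a \<Rightarrow> nat" where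
  "red_degree G x = card {e \<in> red G. x \<in> e}"

definition contract :: "'a \<Rightarrow> 'a \<Rightarrow> 'a \<Rightarrow> 'a trigraph \<Rightarrow> 'a trigraph" where
  "contract u v w G =
     (let V' = verts G - {u, v};
          both_black = {x \<in> V'. {u, x} \<in> black G \<and> {v, x} \<in> black G};
          both_non = {x \<in> V'. {u, x} \<notin> black G \<union> red G \<and> {v, x} \<notin> black G \<union> red G}
      in \<lparr>verts = insert w V',
          black = {e \<in> black G. u \<notin> e \<and> v \<notin> e} \<union> {{w, x} | x. x \<in> both_black},
          red = {e \<in> red G. u \<notin> e \<and> v \<notin> e} \<union> {{w, x} | x. x \<in> V' - both_black - both_non}\<rparr>)"

definition contraction_step :: "'a trigraph \<Rightarrow> 'a trigraph \<Rightarrow> bool" where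
  "contraction_step G G' \<longleftrightarrow>
     (\<exists>u \<in> verts G. \<exists>v \<in> verts G. u \<noteq> v \<and> (\<exists>w. w \<notin> verts G \<and> G' = contract u v w G))"

definition is_contraction_seq :: "nat \<Rightarrow> 'a trigraph \<Rightarrow> 'a trigraph list \<Rightarrow> bool" where
  "is_contraction_seq d G Gs \<longleftrightarrow>
     Gs \<noteq> [] \<and> hd Gs = G \<and> card (verts (last Gs)) = 1 \<and> successively contraction_step Gs
     \<and> (\<forall>H \<in> set Gs. is_trigraph H \<and> (\<forall>x \<in> verts H. red_degree H x \<le> d))"

text \<open>The type of vertices is infinite so that a fresh vertex for a contraction always exists.
  The value is meaningful for trigraphs with at least one vertex; otherwise no contraction
  sequence exists.\<close>

definition tww :: "('a::infinite) trigraph \<Rightarrow> nat" where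
  "tww G = (LEAST d. \<exists>Gs. is_contraction_seq d G Gs)"

text \<open>The binomial random graph on \<open>{1..n}\<close>, as a distribution on edge sets. Each potential edge
  gets an independent Bernoulli indicator (which is fixed to \<open>False\<close> outside the potential edges);
  the graph consists of those pairs whose indicator is \<open>True\<close>.\<close>

definition random_graph :: "nat \<Rightarrow> real \<Rightarrow> nat set set pmf" where
  "random_graph n p =
     map_pmf (\<lambda>f. {e \<in> all_pairs {1..n}. f e})
       (Pi_pmf (all_pairs {1..n}) False (\<lambda>_. bernoulli_pmf p))"

lemma is_trigraph_contract:
  assumes G: "is_trigraph G" and w: "w \<notin> verts G"
  shows "is_trigraph (contract u v w G)"
proof -
  let ?H = "contract u v w G"
  have fresh: "w \<notin> e" if "e \<in> black G \<union> red G" for e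
    using that G w by (auto simp: is_trigraph_def all_pairs_def)
  have pair: "{w, x} \<in> all_pairs (verts ?H)" if "x \<in> verts G - {u, v}" for x
  proof -
    have "x \<noteq> w" using that w by blast
    then show ?thesis using that by (simp add: all_pairs_def contract_def Let_def)
  qed
  have keep: "e \<in> all_pairs (verts ?H)" if "e \<in> black G \<union> red G" "u \<notin> e" "v \<notin> e" for e
  proof -
    have "e \<subseteq> verts G" "card e = 2"
      using that(1) G by (auto simp: is_trigraph_def all_pairs_def)
    then have "e \<subseteq> verts G - {u, v}" using that(2,3) by blast
    then show ?thesis using \<open>card e = 2\<close> by (auto simp: all_pairs_def contract_def Let_def)
  qed
  have "finite (verts ?H)"
    using G by (simp add: is_trigraph_def contract_def Let_def)
  moreover have "e \<in> all_pairs (verts ?H)" if "e \<in> black ?H \<union> red ?H" for e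
  proof -
    have "(e \<in> black G \<union> red G \<and> u \<notin> e \<and> v \<notin> e) \<or> (\<exists>x\<in>verts G - {u, v}. e = {w, x})"
      using that by (auto simp: contract_def Let_def)
    then show ?thesis
    proof (elim disjE conjE bexE)
      assume "e \<in> black G \<union> red G" "u \<notin> e" "v \<notin> e"
      then show ?thesis by (rule keep)
    next
      fix x assume x: "x \<in> verts G - {u, v}" and e: "e = {w, x}"
      show ?thesis unfolding e using x by (rule pair)
    qed
  qed
  moreover have False if e: "e \<in> black ?H" "e \<in> red ?H" for e
  proof (cases "w \<in> e")
    case True
    obtain x y where "e = {w, x}" "{u, x} \<in> black G" "{v, x} \<in> black G"
        "e = {w, y}" "y \<in> verts G" "\<not> ({u, y} \<in> black G \<and> {v, y} \<in> black G)"
      using e True fresh by (auto simp: contract_def Let_def)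
    then show False using w by (auto simp: doubleton_eq_iff)
  next
    case False
    then have "e \<in> black G \<inter> red G"
      using e by (auto simp: contract_def Let_def)
    then show False using G by (auto simp: is_trigraph_def)
  qed
  ultimately show ?thesis unfolding is_trigraph_def by blast
qed

lemma contraction_seq_exists:
  fixes G :: "('a::infinite) trigraph"
  assumes "is_trigraph G" "verts G \<noteq> {}"
  shows "\<exists>d Gs. is_contraction_seq d G Gs"
  using assms
proof (induction "card (verts G)" arbitrary: G rule: less_induct)
  case less
  have fin: "finite (verts G)" using less.prems by (simp add: is_trigraph_def)
  have finb: "\<exists>d. \<forall>x\<in>verts G. red_degree G x \<le> d"
    using fin by (intro exI[of _ "\<Sum>x\<in>verts G. red_degree G x"]) (auto intro: member_le_sum)
  then obtain d0 where d0: "\<forall>x\<in>verts G. red_degree G x \<le> d0" by blast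
  show ?case
  proof (cases "card (verts G) = 1")
    case True
    then have "is_contraction_seq d0 G [G]"
      using d0 less.prems by (simp add: is_contraction_seq_def)
    then show ?thesis by blast
  next
    case False
    obtain u where u: "u \<in> verts G" using less.prems by blast
    have "\<exists>v\<in>verts G. v \<noteq> u"
    proof (rule ccontr)
      assume "\<not> ?thesis"
      then have "verts G = {u}" using u by blast
      then show False using False by simp
    qed
    then obtain v where v: "v \<in> verts G" "v \<noteq> u" by blast
    obtain w where w: "w \<notin> verts G" using fin arb_element by blast
    let ?H = "contract u v w G"
    have vH: "verts ?H = insert w (verts G - {u, v})" by (simp add: contract_def Let_def)
    have "card (verts ?H) = Suc (card (verts G) - 2)"
      using fin w u v by (simp add: vH card_Diff_subset)
    moreover have "card (verts G) \<ge> 2"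
      using card_mono[OF fin, of "{u, v}"] u v by simp
    ultimately have "card (verts ?H) < card (verts G)" by linarith
    moreover have tH: "is_trigraph ?H" by (rule is_trigraph_contract[OF less.prems(1) w])
    moreover have "verts ?H \<noteq> {}" by (simp add: vH)
    ultimately have "\<exists>d Gs. is_contraction_seq d ?H Gs"
      by (rule less.hyps)
    then obtain d Gs where s: "is_contraction_seq d ?H Gs" by (elim exE)
    have st: "contraction_step G ?H"
      unfolding contraction_step_def using u(1) v w by (intro bexI[of _ u] bexI[of _ v]) auto
    have "successively contraction_step (G # Gs)"
      using s st by (simp add: is_contraction_seq_def successively_Cons)
    moreover have "card (verts (last (G # Gs))) = 1"
      using s by (simp add: is_contraction_seq_def)
    moreover have "is_trigraph K \<and> (\<forall>x\<in>verts K. red_degree K x \<le> max d d0)" if "K \<in> set (G # Gs)" for K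
    proof (cases "K = G")
      case True
      then show ?thesis using d0 less.prems(1) by (simp add: le_max_iff_disj)
    next
      case False
      then show ?thesis using that s by (simp add: is_contraction_seq_def le_max_iff_disj)
    qed
    ultimately have "is_contraction_seq (max d d0) G (G # Gs)"
      unfolding is_contraction_seq_def by simp
    then show ?thesis by blast
  qed
qed

end

theory Submission
  imports Defs "HOL-Combinatorics.Transposition" "HOL-Real_Asymp.Real_Asymp"
begin

text \<open>
Write \<open>d = n p\<close>. The bound \<open>(1 - \<delta>) (d - 4 / \<delta>)\<close> is at most \<open>0\<close> unless \<open>d > 4 / \<delta> > 7\<close>,
so assume \<open>d > 7\<close> and let \<open>k\<close> be the bound rounded down; in particular \<open>k \<le> (1 - \<delta>) d\<close>.
It has to be shown that the random graph is unlikely to have a \<open>k\<close>-contraction sequence.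
Two different reasons apply, depending on how sparse the graph is.

\<^emph>\<open>Sparse case\<close>, \<open>p \<le> n powr (- 7 / 8)\<close>: there are too few graphs of small twin-width.
Undoing the contraction that merged \<open>u\<close> and \<open>v\<close> requires naming \<open>u\<close> and \<open>v\<close> and recovering the
pairs that the contraction obscured. These are \<open>uv\<close> and the pairs \<open>ux\<close> and \<open>vx\<close> for the at most
\<open>k\<close> red neighbours \<open>x\<close> of the merged vertex, since a black edge or a non-edge at the merged vertex
determines both original pairs. Hence there are at most \<open>(n\<^sup>2 * 4 * 16 ^ k) ^ n\<close> trigraphs on
\<open>n\<close> given vertices with a \<open>k\<close>-contraction sequence (\<open>card_narrow_le\<close>). On the other hand,
with high probability there are at least \<open>7 / 8\<close> of the expected \<open>d (n - 1) / 2\<close> edges, and a fixed graph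
with that many edges has probability at most \<open>p powr (7 / 16 * d * (n - 1))\<close>. The exponent of the
count is about \<open>2 n ln n + O(d n)\<close>, that of the probability at most about
\<open>- 49 / 128 * d n ln n\<close>. As \<open>d \<ge> 7\<close> and \<open>2 < 7 * 49 / 128\<close>, the probability wins.

\<^emph>\<open>Dense case\<close>, \<open>p > n powr (- 7 / 8)\<close>: already the first contraction fails. Contracting \<open>u\<close> and
\<open>v\<close> in a graph produces a red edge to each vertex adjacent to exactly one of them. Given the edges at
\<open>u\<close>, every other vertex is of this kind independently with probability \<open>p\<close> or \<open>1 - p\<close>, so with
probability at least \<open>p\<close>. By a Chernoff bound, a fixed pair has at most \<open>(1 - \<delta>) d\<close> such
vertices with probability at most \<open>exp (1 - \<delta>\<^sup>2 d / 2)\<close>. Here \<open>d \<ge> n powr (1 / 8)\<close>, so this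
survives a union bound over all pairs (\<open>prob_narrow_le_similar_pair\<close>).

The same Chernoff bound, \<open>prob_few_disagreements_le\<close>, controls the number of edges in the sparse
case.
\<close>

section \<open>Contraction sequences that keep the name of a merged vertex\<close>

text \<open>
Counting trigraphs on a fixed vertex set is awkward if every contraction introduces an arbitrary
fresh vertex. Giving the merged vertex the name of one of its two constituents keeps all vertex
sets inside the original one; since only the isomorphism type matters, this loses nothing.
\<close>

definition rename :: "('a \<Rightarrow> 'a) \<Rightarrow> 'a trigraph \<Rightarrow> 'a trigraph" where
  "rename \<pi> G = \<lparr>verts = \<pi> ` verts G, black = (`) \<pi> ` black G, red = (`) \<pi> ` red G\<rparr>"

lemma rename_sel [simp]:
  "verts (rename \<pi> G) = \<pi> ` verts G"
  "black (rename \<pi> G) = (`) \<pi> ` black G"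
  "red (rename \<pi> G) = (`) \<pi> ` red G"
  by (simp_all add: rename_def)

lemma inj_image_image: "inj \<pi> \<Longrightarrow> inj ((`) \<pi>)"
  by (simp add: inj_on_def inj_image_eq_iff)

lemma inj_image_pair_mem_iff:
  assumes "inj \<pi>"
  shows "{\<pi> a, \<pi> b} \<in> (`) \<pi> ` B \<longleftrightarrow> {a, b} \<in> B"
  using inj_image_mem_iff[OF inj_image_image[OF assms], of "{a, b}" B] by simp

lemma is_trigraph_rename:
  assumes "inj \<pi>" "is_trigraph G"
  shows "is_trigraph (rename \<pi> G)"
proof -
  have inj2: "inj ((`) \<pi>)" using assms(1) by (rule inj_image_image)
  have pairs: "(`) \<pi> ` B \<subseteq> all_pairs (\<pi> ` V)" if "B \<subseteq> all_pairs V" for B V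
    using that assms(1) by (auto simp: all_pairs_def card_image inj_on_subset)
  have "(`) \<pi> ` black G \<inter> (`) \<pi> ` red G = (`) \<pi> ` (black G \<inter> red G)"
    using image_Int[OF inj2] by simp
  then show ?thesis
    using assms(2) pairs by (simp add: is_trigraph_def)
qed

lemma red_degree_rename:
  assumes "inj \<pi>"
  shows "red_degree (rename \<pi> G) (\<pi> x) = red_degree G x"
proof -
  have "\<pi> x \<in> \<pi> ` e \<longleftrightarrow> x \<in> e" for e
    using assms by (rule inj_image_mem_iff)
  then have "{e \<in> red (rename \<pi> G). \<pi> x \<in> e} = (`) \<pi> ` {e \<in> red G. x \<in> e}"
    unfolding rename_sel by blast
  moreover have "inj_on ((`) \<pi>) {e \<in> red G. x \<in> e}"
    using inj_image_image[OF assms] by (rule inj_on_subset) simp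
  ultimately show ?thesis by (simp add: red_degree_def card_image)
qed

lemma rename_contract:
  assumes "inj \<pi>"
  shows "rename \<pi> (contract u v w G) = contract (\<pi> u) (\<pi> v) (\<pi> w) (rename \<pi> G)"
proof -
  have V: "\<pi> ` (verts G - {u, v}) = \<pi> ` verts G - {\<pi> u, \<pi> v}"
    using assms by (auto simp: inj_eq)
  have mem: "\<pi> a \<in> \<pi> ` e \<longleftrightarrow> a \<in> e" for a e
    using assms by (rule inj_image_mem_iff)
  have keep: "(`) \<pi> ` {e \<in> B. u \<notin> e \<and> v \<notin> e} = {e \<in> (`) \<pi> ` B. \<pi> u \<notin> e \<and> \<pi> v \<notin> e}" for B
    using mem by blast
  have new: "(`) \<pi> ` {{w, x} | x. x \<in> X} = {{\<pi> w, x} | x. x \<in> \<pi> ` X}" for X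
    unfolding Setcompr_eq_image image_image by simp
  have both: "\<pi> ` {x \<in> verts G - {u, v}. P x} = {x \<in> \<pi> ` verts G - {\<pi> u, \<pi> v}. Q x}"
    if "\<And>x. Q (\<pi> x) \<longleftrightarrow> P x" for P Q
    unfolding V[symmetric] using that by blast
  have diff: "\<pi> ` (X - Y) = \<pi> ` X - \<pi> ` Y" for X Y
    using assms by (rule image_set_diff)
  have U: "(`) \<pi> ` black G \<union> (`) \<pi> ` red G = (`) \<pi> ` (black G \<union> red G)" by (simp only: image_Un)
  have bb: "\<pi> ` {x \<in> verts G - {u, v}. {u, x} \<in> black G \<and> {v, x} \<in> black G}
      = {x \<in> \<pi> ` verts G - {\<pi> u, \<pi> v}. {\<pi> u, x} \<in> (`) \<pi> ` black G \<and> {\<pi> v, x} \<in> (`) \<pi> ` black G}"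
    by (rule both) (simp only: inj_image_pair_mem_iff[OF assms])
  have bn: "\<pi> ` {x \<in> verts G - {u, v}. {u, x} \<notin> black G \<union> red G \<and> {v, x} \<notin> black G \<union> red G}
      = {x \<in> \<pi> ` verts G - {\<pi> u, \<pi> v}. {\<pi> u, x} \<notin> (`) \<pi> ` black G \<union> (`) \<pi> ` red G
          \<and> {\<pi> v, x} \<notin> (`) \<pi> ` black G \<union> (`) \<pi> ` red G}"
    unfolding U by (rule both) (simp only: inj_image_pair_mem_iff[OF assms])
  show ?thesis
    unfolding contract_def Let_def rename_def trigraph.select_convs
      image_Un keep new image_insert[of \<pi> w] bb[symmetric] bn[symmetric] diff[of "verts G - {u, v}"]
      diff[of "_ - _"] V
    by (rule refl)
qed

text \<open>
Existence of a \<open>k\<close>-contraction sequence in which \<open>v\<close> is always merged into \<open>u\<close>.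
\<close>
inductive narrow :: "nat \<Rightarrow> 'a trigraph \<Rightarrow> bool" for k where
  single: "\<lbrakk>is_trigraph G; \<forall>x\<in>verts G. red_degree G x \<le> k; card (verts G) = 1\<rbrakk> \<Longrightarrow> narrow k G"
| merge: "\<lbrakk>is_trigraph G; \<forall>x\<in>verts G. red_degree G x \<le> k; u \<in> verts G; v \<in> verts G; u \<noteq> v;
    narrow k (contract u v u G)\<rbrakk> \<Longrightarrow> narrow k G"

lemma narrow_rename:
  assumes "inj \<pi>" "narrow k G"
  shows "narrow k (rename \<pi> G)"
  using assms(2)
proof induction
  case (single G)
  then show ?case
    using assms(1)
    by (intro narrow.single) (auto simp: is_trigraph_rename red_degree_rename card_image inj_on_subset)
next
  case (merge G u v)
  then show ?case
    using assms(1)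
    by (intro narrow.merge[where u = "\<pi> u" and v = "\<pi> v" and G = "rename \<pi> G"])
      (auto simp: is_trigraph_rename red_degree_rename rename_contract inj_eq)
qed

text \<open>
A fresh name and the name of the first vertex differ by a transposition: it leaves every edge
avoiding both names in place.
\<close>
lemma contract_fresh_eq_rename:
  assumes G: "is_trigraph G" and w: "w \<notin> verts G"
  shows "contract u v u G = rename (Transposition.transpose u w) (contract u v w G)"
proof -
  let ?t = "Transposition.transpose u w"
  have same: "?t ` e = e" if "u \<notin> e" "w \<notin> e" for e
    using that by (auto simp: Transposition.transpose_def image_iff)
  have fresh: "w \<notin> e" if "e \<in> black G \<union> red G" for e
    using that G w by (auto simp: is_trigraph_def all_pairs_def)
  have V: "?t ` insert w (verts G - {u, v}) = insert u (verts G - {u, v})"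
    using w same[of "verts G - {u, v}"] by (simp)
  have keep: "(`) ?t ` {e \<in> B. u \<notin> e \<and> v \<notin> e} = {e \<in> B. u \<notin> e \<and> v \<notin> e}"
    if "B \<subseteq> black G \<union> red G" for B
  proof -
    have "(`) ?t ` {e \<in> B. u \<notin> e \<and> v \<notin> e} = id ` {e \<in> B. u \<notin> e \<and> v \<notin> e}"
    proof (intro image_cong refl)
      fix e assume "e \<in> {e \<in> B. u \<notin> e \<and> v \<notin> e}"
      then have "u \<notin> e" "w \<notin> e" using that fresh by blast+
      then show "?t ` e = id e" by (simp add: same)
    qed
    then show ?thesis by simp
  qed
  have new: "(`) ?t ` {{w, x} | x. x \<in> X} = {{u, x} | x. x \<in> X}" if "X \<subseteq> verts G - {u, v}" for X
  proof -
    have "?t ` {w, x} = {u, x}" if "x \<in> X" for x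
    proof -
      have "x \<noteq> u" "x \<noteq> w" using that \<open>X \<subseteq> _\<close> w by blast+
      then show ?thesis by simp
    qed
    then have "(\<lambda>x. ?t ` {w, x}) ` X = (\<lambda>x. {u, x}) ` X" by (intro image_cong refl)
    then show ?thesis unfolding Setcompr_eq_image image_image by simp
  qed
  have new_filter: "(`) ?t ` {{w, x} | x. x \<in> {x \<in> verts G - {u, v}. P x}}
      = {{u, x} | x. x \<in> {x \<in> verts G - {u, v}. P x}}" for P
    by (rule new) blast
  have new_diff: "(`) ?t ` {{w, x} | x. x \<in> verts G - {u, v} - X - Y}
      = {{u, x} | x. x \<in> verts G - {u, v} - X - Y}" for X Y
    by (rule new) blast
  show ?thesis
    unfolding contract_def Let_def rename_def trigraph.select_convs image_Un
      keep[OF Un_upper1] keep[OF Un_upper2] new_filter new_diff V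
    by (rule refl)
qed

lemma narrow_if_contraction_seq:
  assumes "is_contraction_seq k G Gs"
  shows "narrow k G"
  using assms
proof (induction Gs arbitrary: G)
  case Nil
  then show ?case by (simp add: is_contraction_seq_def)
next
  case (Cons K Gs)
  then have K: "K = G" and G: "is_trigraph G" and deg: "\<forall>x\<in>verts G. red_degree G x \<le> k"
    by (auto simp: is_contraction_seq_def)
  show ?case
  proof (cases Gs)
    case Nil
    then show ?thesis
      using Cons.prems K G deg by (intro narrow.single) (auto simp: is_contraction_seq_def)
  next
    case (Cons H Hs)
    have seq: "is_contraction_seq k H Gs"
      using Cons.prems Cons by (auto simp: is_contraction_seq_def)
    have "contraction_step G H"
      using Cons.prems Cons K by (auto simp: is_contraction_seq_def)
    then obtain u v w where uvw: "u \<in> verts G" "v \<in> verts G" "u \<noteq> v" "w \<notin> verts G"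
      and H: "H = contract u v w G"
      by (auto simp: contraction_step_def)
    have "narrow k (contract u v u G)"
      unfolding contract_fresh_eq_rename[OF G uvw(4)]
      using Cons.IH[OF seq] by (intro narrow_rename) (auto simp: H)
    then show ?thesis
      using narrow.merge[OF G deg uvw(1,2,3)] by blast
  qed
qed

lemma narrow_tww:
  fixes G :: "('a::infinite) trigraph"
  assumes "is_trigraph G" "verts G \<noteq> {}" "tww G \<le> k"
  shows "narrow k G"
proof -
  obtain Gs where "is_contraction_seq (tww G) G Gs"
    using LeastI_ex[OF contraction_seq_exists[OF assms(1,2)]] unfolding tww_def by blast
  then have "is_contraction_seq k G Gs"
    using assms(3) unfolding is_contraction_seq_def by (meson order_trans)
  then show ?thesis by (rule narrow_if_contraction_seq)
qed

section \<open>Counting trigraphs of small twin-width\<close>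

lemma red_contract_iff:
  "{u, x} \<in> red (contract u v u G) \<longleftrightarrow>
    x \<in> verts G - {u, v} \<and>
    \<not> ({u, x} \<in> black G \<and> {v, x} \<in> black G) \<and>
    ({u, x} \<in> black G \<union> red G \<or> {v, x} \<in> black G \<union> red G)"
  by (auto simp: contract_def Let_def doubleton_eq_iff)

lemma black_contract_iff:
  "{u, x} \<in> black (contract u v u G) \<longleftrightarrow>
    x \<in> verts G - {u, v} \<and> {u, x} \<in> black G \<and> {v, x} \<in> black G"
  by (auto simp: contract_def Let_def doubleton_eq_iff)

lemma keep_contract_iff:
  assumes "u \<notin> e" "v \<notin> e"
  shows "e \<in> black (contract u v u G) \<longleftrightarrow> e \<in> black G"
    and "e \<in> red (contract u v u G) \<longleftrightarrow> e \<in> red G"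
  using assms by (auto simp: contract_def Let_def)

lemma verts_contract: "u \<in> verts G \<Longrightarrow> u \<noteq> v \<Longrightarrow> verts (contract u v u G) = verts G - {v}"
  by (auto simp: contract_def Let_def)

lemma red_degree_eq_card_neighbours:
  assumes "is_trigraph G"
  shows "red_degree G x = card {y. {x, y} \<in> red G}"
proof -
  have two: "card e = 2" if "e \<in> red G" for e
    using that assms by (auto simp: is_trigraph_def all_pairs_def)
  have "{e \<in> red G. x \<in> e} = (\<lambda>y. {x, y}) ` {y. {x, y} \<in> red G}"
  proof (intro equalityI subsetI)
    fix e assume e: "e \<in> {e \<in> red G. x \<in> e}"
    then obtain y where "e = {x, y}"
      using two[of e] by (auto simp: card_2_iff)
    then show "e \<in> (\<lambda>y. {x, y}) ` {y. {x, y} \<in> red G}" using e by blast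
  qed auto
  moreover have "inj_on (\<lambda>y. {x, y}) {y. {x, y} \<in> red G}"
    by (auto simp: inj_on_def doubleton_eq_iff)
  ultimately show ?thesis by (simp add: red_degree_def card_image)
qed

text \<open>
Only the pairs in \<open>X\<close>, namely \<open>uv\<close> and those joining \<open>u\<close> or \<open>v\<close> to a red neighbour of \<open>u\<close> in
\<open>H\<close>, are lost in the contraction, and there are at most \<open>2 k + 1\<close> of them. Each of these pairs
is or is not black, and is or is not red, which gives \<open>4 ^ (2 k + 1)\<close> possibilities.
\<close>
lemma card_trigraphs_contracting_to_le:
  fixes V :: "'a set"
  assumes V: "finite V" "u \<in> V" "v \<in> V" "u \<noteq> v" and deg: "red_degree H u \<le> k" and H: "is_trigraph H"
  shows "card {G. is_trigraph G \<and> verts G = V \<and> contract u v u G = H} \<le> 4 * 16 ^ k"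
    and "finite {G. is_trigraph G \<and> verts G = V \<and> contract u v u G = H}"
proof -
  let ?S = "{G. is_trigraph G \<and> verts G = V \<and> contract u v u G = H}"
  define R where "R = {x. {u, x} \<in> red H}"
  define X where "X = insert {u, v} ((\<lambda>x. {u, x}) ` R \<union> (\<lambda>x. {v, x}) ` R)"
  define code where "code G = (black G \<inter> X, red G \<inter> X)" for G :: "'a trigraph"
  have "R \<subseteq> verts H"
    using H by (auto simp: R_def is_trigraph_def all_pairs_def)
  then have finR: "finite R" using H by (auto simp: is_trigraph_def intro: finite_subset)
  have cardR: "card R \<le> k"
    using deg red_degree_eq_card_neighbours[OF H, of u] by (simp add: R_def)
  have finX: "finite X" using finR by (simp add: X_def)
  have "card X \<le> Suc (card ((\<lambda>x. {u, x}) ` R \<union> (\<lambda>x. {v, x}) ` R))"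
    unfolding X_def by (rule card_insert_le_m1) simp_all
  also have "\<dots> \<le> Suc (card R + card R)"
    by (intro Suc_leI le_imp_less_Suc order_trans[OF card_Un_le] add_mono card_image_le finR)
  finally have cardX: "card X \<le> 2 * k + 1" using cardR by simp
  \<comment> \<open>Outside \<open>X\<close>, a pair at \<open>u\<close> or \<open>v\<close> is never red, and it is black precisely if the pair
    obtained by replacing \<open>v\<close> by \<open>u\<close> is black in \<open>H\<close>.\<close>
  have determined: "e \<in> black G \<longleftrightarrow> (if u \<notin> e \<and> v \<notin> e then e \<in> black H else e - {u, v} \<union> {u} \<in> black H)"
    "e \<in> red G \<longleftrightarrow> u \<notin> e \<and> v \<notin> e \<and> e \<in> red H"
    if G: "G \<in> ?S" and e: "e \<in> all_pairs V" "e \<notin> X" for G e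
  proof -
    have tG: "is_trigraph G" "verts G = V" and HG: "H = contract u v u G" using G by auto
    consider "u \<notin> e" "v \<notin> e" | x where "e = {u, x} \<or> e = {v, x}" "x \<in> V - {u, v}"
    proof (cases "u \<notin> e \<and> v \<notin> e")
      case False
      then obtain a x where ax: "e = {a, x}" "a \<in> {u, v}" "x \<noteq> a"
        using e(1) by (auto simp: all_pairs_def card_2_iff insert_commute)
      moreover have "x \<in> V" using e(1) ax by (auto simp: all_pairs_def)
      moreover have "x \<notin> {u, v}" using ax e(2) by (auto simp: X_def insert_commute)
      ultimately show ?thesis using that(2)[of x] by blast
    qed (use that in blast)
    then have "(e \<in> black G \<longleftrightarrow> (if u \<notin> e \<and> v \<notin> e then e \<in> black H else e - {u, v} \<union> {u} \<in> black H))
       \<and> (e \<in> red G \<longleftrightarrow> u \<notin> e \<and> v \<notin> e \<and> e \<in> red H)"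
    proof cases
      case 1
      then show ?thesis unfolding HG by (simp add: keep_contract_iff)
    next
      case 2
      then have "x \<notin> R" using e(2) by (auto simp: X_def)
      then have "{u, x} \<notin> red H" by (simp add: R_def)
      then have nr: "({u, x} \<in> black G \<and> {v, x} \<in> black G) \<or>
          ({u, x} \<notin> black G \<union> red G \<and> {v, x} \<notin> black G \<union> red G)"
        using 2(2) tG unfolding HG red_contract_iff by blast
      have "e - {u, v} \<union> {u} = {u, x}" using 2 by auto
      moreover have "{u, x} \<in> black H \<longleftrightarrow> {u, x} \<in> black G \<and> {v, x} \<in> black G"
        using 2(2) tG unfolding HG black_contract_iff by blast
      moreover have "e \<in> black G \<Longrightarrow> e \<notin> red G" using tG by (auto simp: is_trigraph_def)
      ultimately show ?thesis using 2(1) nr by auto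
    qed
    then show "e \<in> black G \<longleftrightarrow> (if u \<notin> e \<and> v \<notin> e then e \<in> black H else e - {u, v} \<union> {u} \<in> black H)"
      "e \<in> red G \<longleftrightarrow> u \<notin> e \<and> v \<notin> e \<and> e \<in> red H" by blast+
  qed
  have "inj_on code ?S"
  proof (rule inj_onI)
    fix G G' assume G: "G \<in> ?S" and G': "G' \<in> ?S" and eq: "code G = code G'"
    have pairs: "black K \<subseteq> all_pairs V" "red K \<subseteq> all_pairs V" if "K \<in> ?S" for K
      using that by (auto simp: is_trigraph_def)
    have X: "black G \<inter> X = black G' \<inter> X" "red G \<inter> X = red G' \<inter> X"
      using eq by (simp_all add: code_def)
    have "e \<in> black G \<longleftrightarrow> e \<in> black G'" and "e \<in> red G \<longleftrightarrow> e \<in> red G'" if "e \<in> all_pairs V" for e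
      using determined[OF G that] determined[OF G' that] X by (cases "e \<in> X"; blast)+
    then have "black G = black G'" "red G = red G'"
      using pairs[OF G] pairs[OF G'] by blast+
    then show "G = G'" using G G' by (intro trigraph.equality) auto
  qed
  moreover have "code ` ?S \<subseteq> Pow X \<times> Pow X" by (auto simp: code_def)
  moreover have fin: "finite (Pow X \<times> Pow X)" using finX by simp
  ultimately have "card ?S \<le> card (Pow X \<times> Pow X)" "finite ?S"
    by (auto intro: card_inj_on_le inj_on_finite)
  moreover have "card (Pow X \<times> Pow X) = 4 ^ card X"
    using finX by (simp add: card_cartesian_product card_Pow power_mult_distrib[symmetric])
  moreover have "(4::nat) ^ card X \<le> 4 ^ (2 * k + 1)"
    using cardX by (intro power_increasing) auto
  ultimately show "card ?S \<le> 4 * 16 ^ k" "finite ?S"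
    by (simp_all add: power_mult)
qed

lemma narrow_is_trigraph: "narrow k G \<Longrightarrow> is_trigraph G"
  and narrow_red_degree: "narrow k G \<Longrightarrow> x \<in> verts G \<Longrightarrow> red_degree G x \<le> k"
  by (auto elim: narrow.cases)

text \<open>
Induction on the number of vertices: a trigraph is determined by its first contraction
\<open>(u, v)\<close>, by the trigraph that results, and by one of \<open>4 * 16 ^ k\<close> ways of undoing the contraction.
\<close>
lemma card_narrow_le:
  fixes V :: "'a set"
  assumes "finite V" "card V \<le> n"
  shows "finite {G. narrow k G \<and> verts G = V}
    \<and> card {G. narrow k G \<and> verts G = V} \<le> (n\<^sup>2 * (4 * 16 ^ k)) ^ card V"
  using assms
proof (induction "card V" arbitrary: V)
  case 0
  have "\<not> narrow k G" if "verts G = {}" for G :: "'a trigraph"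
    using that by (auto elim: narrow.cases)
  then have "{G. narrow k G \<and> verts G = V} = {}" using 0 by auto
  then show ?case by (simp only:) simp
next
  case (Suc t)
  let ?S = "{G. narrow k G \<and> verts G = V}"
  let ?N = "\<lambda>v. {H. narrow k H \<and> verts H = V - {v}}"
  let ?ext = "\<lambda>u v H. {G. is_trigraph G \<and> verts G = V \<and> contract u v u G = H}"
  let ?c = "n\<^sup>2 * (4 * 16 ^ k)"
  show ?case
  proof (cases "card V = 1")
    case True
    then obtain a where a: "V = {a}" by (auto simp: card_1_singleton_iff)
    have "all_pairs V = {}" unfolding a by (auto simp: all_pairs_def dest: card_mono[rotated])
    then have sub: "?S \<subseteq> {\<lparr>verts = V, black = {}, red = {}\<rparr>}"
      by (auto simp: is_trigraph_def dest!: narrow_is_trigraph)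
    then have "card ?S \<le> 1" using card_mono[OF _ sub] by simp
    moreover have "1 \<le> ?c ^ card V"
      using Suc.prems True by (intro one_le_power) auto
    ultimately show ?thesis using sub by (auto intro: finite_subset)
  next
    case False
    define W where "W = {(u, v) \<in> V \<times> V. u \<noteq> v}"
    define U where "U = (\<Union>(u, v)\<in>W. \<Union>H\<in>?N v. ?ext u v H)"
    have IH: "finite (?N v)" "card (?N v) \<le> ?c ^ t" if "v \<in> V" for v
    proof -
      have "card (V - {v}) = t" using that Suc.hyps(2) Suc.prems by simp
      then show "finite (?N v)" "card (?N v) \<le> ?c ^ t"
        using Suc.hyps(1)[of "V - {v}"] Suc.prems(2) Suc.hyps(2) Suc.prems(1) by auto
    qed
    have ext: "card (?ext u v H) \<le> 4 * 16 ^ k" "finite (?ext u v H)"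
      if "u \<in> V" "v \<in> V" "u \<noteq> v" "H \<in> ?N v" for u v H
      using that Suc.prems
      by (intro card_trigraphs_contracting_to_le; auto dest: narrow_is_trigraph narrow_red_degree)+
    have inner: "card (\<Union>H\<in>?N v. ?ext u v H) \<le> ?c ^ t * (4 * 16 ^ k)"
      if uv: "u \<in> V" "v \<in> V" "u \<noteq> v" for u v
    proof -
      have "card (\<Union>H\<in>?N v. ?ext u v H) \<le> (\<Sum>H\<in>?N v. card (?ext u v H))"
        using IH[OF uv(2)] by (intro card_UN_le)
      also have "\<dots> \<le> (\<Sum>H\<in>?N v. 4 * 16 ^ k)"
        using ext(1)[OF uv] by (rule sum_mono)
      also have "\<dots> = card (?N v) * (4 * 16 ^ k)" by simp
      also have "\<dots> \<le> ?c ^ t * (4 * 16 ^ k)" using IH(2)[OF uv(2)] by (rule mult_right_mono) simp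
      finally show ?thesis .
    qed
    have finVV: "finite (V \<times> V)" using Suc.prems(1) by simp
    have W: "W \<subseteq> V \<times> V" unfolding W_def by blast
    have finW: "finite W" using W finVV by (rule finite_subset)
    have "card W \<le> card (V \<times> V)" using finVV W by (rule card_mono)
    also have "\<dots> \<le> n\<^sup>2"
      unfolding card_cartesian_product power2_eq_square using Suc.prems(2) by (intro mult_le_mono)
    finally have cardW: "card W \<le> n\<^sup>2" .
    have "?S \<subseteq> U"
    proof
      fix G assume G: "G \<in> ?S"
      then have "narrow k G" by simp
      then show "G \<in> U"
      proof cases
        case single
        then show ?thesis using G False by auto
      next
        case (merge u v)
        then have "contract u v u G \<in> ?N v" using G by (auto simp: verts_contract)
        moreover have "(u, v) \<in> W" using merge(3-5) G by (simp add: W_def)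
        ultimately show ?thesis unfolding U_def using merge(1) G by blast
      qed
    qed
    moreover have finU: "finite U"
      unfolding U_def
    proof (rule finite_UN_I[OF finW])
      fix w assume "w \<in> W"
      then obtain u v where w: "w = (u, v)" and uv: "u \<in> V" "v \<in> V" "u \<noteq> v" unfolding W_def by blast
      show "finite (case w of (u, v) \<Rightarrow> \<Union>H\<in>?N v. ?ext u v H)"
        unfolding w prod.case by (rule finite_UN_I[OF IH(1)[OF uv(2)] ext(2)[OF uv]])
    qed
    ultimately have fin: "finite ?S" and "card ?S \<le> card U"
      by (rule finite_subset, intro card_mono)
    note this(2)
    also have "card U \<le> (\<Sum>w\<in>W. card (case w of (u, v) \<Rightarrow> \<Union>H\<in>?N v. ?ext u v H))"
      unfolding U_def by (rule card_UN_le[OF finW])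
    also have "\<dots> \<le> (\<Sum>w\<in>W. ?c ^ t * (4 * 16 ^ k))"
    proof (rule sum_mono)
      fix w assume "w \<in> W"
      then obtain u v where w: "w = (u, v)" and uv: "u \<in> V" "v \<in> V" "u \<noteq> v" unfolding W_def by blast
      show "card (case w of (u, v) \<Rightarrow> \<Union>H\<in>?N v. ?ext u v H) \<le> ?c ^ t * (4 * 16 ^ k)"
        unfolding w prod.case by (rule inner[OF uv])
    qed
    also have "\<dots> = card W * (?c ^ t * (4 * 16 ^ k))" by simp
    also have "\<dots> \<le> n\<^sup>2 * (?c ^ t * (4 * 16 ^ k))"
      using cardW by (rule mult_right_mono) simp
    also have "\<dots> = ?c ^ card V" using Suc.hyps(2)[symmetric] by simp
    finally show ?thesis using fin by blast
  qed
qed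

section \<open>A Chernoff bound\<close>

lemma exp_minus_le_quadratic:
  fixes x :: real
  assumes "0 \<le> x"
  shows "exp (- x) \<le> 1 - x + x\<^sup>2 / 2"
proof -
  have "(1 + x + x\<^sup>2 / 2) * (1 - x + x\<^sup>2 / 2) = 1 + (x\<^sup>2)\<^sup>2 / 4"
    by (simp add: algebra_simps power2_eq_square)
  then have "1 \<le> (1 + x + x\<^sup>2 / 2) * (1 - x + x\<^sup>2 / 2)"
    by simp
  also have "\<dots> \<le> exp x * (1 - x + x\<^sup>2 / 2)"
  proof (rule mult_right_mono)
    show "1 + x + x\<^sup>2 / 2 \<le> exp x" using assms by (rule exp_lower_Taylor_quadratic)
    have "1 - x + x\<^sup>2 / 2 = ((1 - x)\<^sup>2 + 1) / 2" by (simp add: power2_eq_square field_simps)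
    then show "0 \<le> 1 - x + x\<^sup>2 / 2" by (simp only:) simp
  qed
  finally show ?thesis by (simp add: exp_minus field_simps)
qed

text \<open>
Each coordinate disagrees with \<open>g\<close> with probability \<open>p\<close> or \<open>1 - p\<close>, hence at least \<open>p\<close>. So
\<open>exp (- \<epsilon> X)\<close>, where \<open>X\<close> counts the disagreements, has expectation at most
\<open>(1 - p (1 - exp (- \<epsilon>))) ^ card A\<close>, and Markov's inequality applies. The function \<open>g\<close> is
arbitrary so that the bound serves both for the number of edges (\<open>g\<close> constantly \<open>False\<close>) and for
comparing the neighbourhood of a vertex with one that has been revealed before.
\<close>
lemma prob_few_disagreements_le:
  fixes p \<epsilon> t :: real and g :: "'a \<Rightarrow> bool"
  assumes A: "finite A" and p: "0 \<le> p" "p \<le> 1 / 2" and \<epsilon>: "0 \<le> \<epsilon>"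
  shows "measure_pmf.prob (Pi_pmf A False (\<lambda>_. bernoulli_pmf p))
            {f. real (card {e \<in> A. f e \<noteq> g e}) \<le> t}
         \<le> exp (\<epsilon> * t - (\<epsilon> - \<epsilon>\<^sup>2 / 2) * p * real (card A))"
proof -
  let ?M = "Pi_pmf A False (\<lambda>_. bernoulli_pmf p)"
  let ?X = "\<lambda>f. real (card {e \<in> A. f e \<noteq> g e})"
  define h where "h e b = (if b \<noteq> g e then exp (- \<epsilon>) else 1)" for e b
  have prod: "exp (- \<epsilon> * ?X f) = (\<Prod>e\<in>A. h e (f e))" for f
  proof -
    have "(\<Prod>e\<in>A. h e (f e)) = exp (- \<epsilon>) ^ card {e \<in> A. f e \<noteq> g e}"
      using A by (simp add: h_def prod.If_cases Int_def)
    then show ?thesis by (simp add: exp_of_nat_mult[symmetric] mult.commute)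
  qed
  have one: "measure_pmf.expectation (bernoulli_pmf p) (h e) \<le> exp (- (\<epsilon> - \<epsilon>\<^sup>2 / 2) * p)" for e
  proof -
    let ?y = "1 - exp (- \<epsilon>)"
    have y: "0 \<le> ?y" using \<epsilon> by simp
    have "measure_pmf.expectation (bernoulli_pmf p) (h e) \<le> 1 - p * ?y"
    proof (cases "g e")
      case True
      have "p * ?y \<le> (1 - p) * ?y" using p y by (intro mult_right_mono) auto
      then show ?thesis using p True by (simp add: h_def algebra_simps)
    next
      case False
      then show ?thesis using p by (simp add: h_def algebra_simps)
    qed
    also have "\<dots> \<le> exp (- (p * ?y))" using exp_ge_add_one_self[of "- (p * ?y)"] by simp
    also have "\<dots> \<le> exp (- (\<epsilon> - \<epsilon>\<^sup>2 / 2) * p)"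
    proof -
      have "p * (\<epsilon> - \<epsilon>\<^sup>2 / 2) \<le> p * ?y"
        using exp_minus_le_quadratic[OF \<epsilon>] p by (intro mult_left_mono) auto
      then show ?thesis by (simp add: mult.commute algebra_simps)
    qed
    finally show ?thesis .
  qed
  have fin: "finite (set_pmf ?M)"
    using A by (intro finite_subset[OF set_Pi_pmf_subset']) (auto intro!: finite_PiE_dflt)
  have "measure_pmf.prob ?M {f. ?X f \<le> t}
      \<le> measure_pmf.prob ?M {f \<in> space (measure_pmf ?M). exp (- \<epsilon> * t) \<le> exp (- \<epsilon> * ?X f)}"
    using \<epsilon> by (intro measure_pmf.finite_measure_mono) (auto intro: mult_left_mono)
  also have "\<dots> \<le> measure_pmf.expectation ?M (\<lambda>f. exp (- \<epsilon> * ?X f)) / exp (- \<epsilon> * t)"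
    using fin by (intro integral_Markov_inequality_measure[where A = "{}"]) 
      (auto intro: integrable_measure_pmf_finite)
  also have "\<dots> \<le> exp (- (\<epsilon> - \<epsilon>\<^sup>2 / 2) * p) ^ card A / exp (- \<epsilon> * t)"
  proof (rule divide_right_mono)
    have "measure_pmf.expectation ?M (\<lambda>f. exp (- \<epsilon> * ?X f))
        = (\<Prod>e\<in>A. measure_pmf.expectation (bernoulli_pmf p) (h e))"
      unfolding prod using A
      by (intro expectation_prod_Pi_pmf) (auto simp: h_def intro: integrable_measure_pmf_finite)
    also have "\<dots> \<le> (\<Prod>e\<in>A. exp (- (\<epsilon> - \<epsilon>\<^sup>2 / 2) * p))"
      using one by (intro prod_mono conjI) (auto simp: h_def intro!: Bochner_Integration.integral_nonneg)
    finally show "measure_pmf.expectation ?M (\<lambda>f. exp (- \<epsilon> * ?X f))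
        \<le> exp (- (\<epsilon> - \<epsilon>\<^sup>2 / 2) * p) ^ card A" by simp
  qed simp
  also have "\<dots> = exp (real (card A) * (- (\<epsilon> - \<epsilon>\<^sup>2 / 2) * p) - - \<epsilon> * t)"
    by (simp only: exp_of_nat_mult exp_diff)
  also have "real (card A) * (- (\<epsilon> - \<epsilon>\<^sup>2 / 2) * p) - - \<epsilon> * t
      = \<epsilon> * t - (\<epsilon> - \<epsilon>\<^sup>2 / 2) * p * real (card A)" by (simp add: algebra_simps)
  finally show ?thesis .
qed

section \<open>The number of edges and the probability of a fixed graph\<close>

lemma finite_all_pairs [simp]: "finite V \<Longrightarrow> finite (all_pairs V)"
  by (auto simp: all_pairs_def)

lemma card_all_pairs: "finite V \<Longrightarrow> card (all_pairs V) = card V choose 2"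
  by (simp add: all_pairs_def n_subsets)

lemma set_random_graph: "E \<in> set_pmf (random_graph n p) \<Longrightarrow> E \<subseteq> all_pairs {1..n}"
  by (auto simp: random_graph_def)

lemma prob_few_edges_le:
  fixes p \<epsilon> t :: real
  assumes "0 \<le> p" "p \<le> 1 / 2" "0 \<le> \<epsilon>"
  shows "measure_pmf.prob (random_graph n p) {E. real (card E) \<le> t}
         \<le> exp (\<epsilon> * t - (\<epsilon> - \<epsilon>\<^sup>2 / 2) * p * real (n choose 2))"
  using prob_few_disagreements_le[of "all_pairs {1..n}" p \<epsilon> "\<lambda>_. False" t] assms
  by (simp add: random_graph_def vimage_def card_all_pairs)

lemma pmf_random_graph_le:
  fixes p :: real
  assumes p: "0 \<le> p" "p \<le> 1"
  shows "pmf (random_graph n p) E \<le> p ^ card E"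
proof (cases "E \<subseteq> all_pairs {1..n}")
  case True
  let ?A = "all_pairs {1..n}" and ?B = "\<lambda>e. if e \<in> E then {True} else UNIV"
  have "pmf (random_graph n p) E
      \<le> measure_pmf.prob (Pi_pmf ?A False (\<lambda>_. bernoulli_pmf p)) (Pi ?A ?B)"
    unfolding random_graph_def pmf_map by (intro measure_pmf.finite_measure_mono) auto
  also have "\<dots> = (\<Prod>e\<in>?A. measure_pmf.prob (bernoulli_pmf p) (?B e))"
    by (intro measure_Pi_pmf_Pi) simp
  also have "\<dots> = (\<Prod>e\<in>?A. if e \<in> E then p else 1)"
    using p by (intro prod.cong refl) (auto simp: measure_pmf_single)
  also have "\<dots> = p ^ card E"
    using True by (simp add: prod.If_cases Int_absorb1)
  finally show ?thesis .
next
  case False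
  then have "pmf (random_graph n p) E = 0"
    using set_random_graph[of E n p] by (auto simp: set_pmf_iff)
  then show ?thesis using p by simp
qed

text \<open>
A union bound over all graphs that satisfy \<open>narrow k\<close>. Restricting it to graphs with more than \<open>t\<close>
edges is what makes every single term small.
\<close>
lemma prob_narrow_many_edges_le:
  fixes p t :: real
  assumes p: "0 < p" "p \<le> 1"
  shows "measure_pmf.prob (random_graph n p)
      {E. narrow k (trigraph_of_graph {1..n} E) \<and> t < real (card E)}
    \<le> (real n ^ 2 * (4 * 16 ^ k)) ^ n * p powr t"
proof -
  let ?S = "{E. narrow k (trigraph_of_graph {1..n} E)}" and ?V = "{1..n}"
  let ?T = "{E. narrow k (trigraph_of_graph {1..n} E) \<and> t < real (card E)}"
  have "inj_on (trigraph_of_graph ?V) ?S" by (auto simp: inj_on_def trigraph_of_graph_def)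
  moreover have "trigraph_of_graph ?V ` ?S \<subseteq> {G. narrow k G \<and> verts G = ?V}"
    by (auto simp: trigraph_of_graph_def)
  moreover have N: "finite {G. narrow k G \<and> verts G = ?V}"
    "card {G. narrow k G \<and> verts G = ?V} \<le> (n\<^sup>2 * (4 * 16 ^ k)) ^ n"
    using card_narrow_le[of ?V n k] by simp_all
  ultimately have S: "finite ?S" "card ?S \<le> (n\<^sup>2 * (4 * 16 ^ k)) ^ n"
    by (blast intro: inj_on_finite, meson card_inj_on_le order_trans)
  have finT: "finite ?T" using S(1) by (rule rev_finite_subset) auto
  have "card ?T \<le> (n\<^sup>2 * (4 * 16 ^ k)) ^ n"
    by (rule order_trans[OF card_mono[OF S(1)] S(2)]) blast
  then have cardT: "real (card ?T) \<le> (real n ^ 2 * (4 * 16 ^ k)) ^ n"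
    by (metis (mono_tags, lifting) of_nat_le_iff of_nat_mult of_nat_numeral of_nat_power)
  have "measure_pmf.prob (random_graph n p) ?T = (\<Sum>E\<in>?T. pmf (random_graph n p) E)"
    using finT by (rule measure_measure_pmf_finite)
  also have "\<dots> \<le> (\<Sum>E\<in>?T. p powr t)"
  proof (rule sum_mono)
    fix E assume "E \<in> ?T"
    then have "p powr real (card E) \<le> p powr t" using p by (intro powr_mono') auto
    then show "pmf (random_graph n p) E \<le> p powr t"
      using pmf_random_graph_le[of p n E] p by (simp add: powr_realpow)
  qed
  also have "\<dots> = real (card ?T) * p powr t" by simp
  also have "\<dots> \<le> (real n ^ 2 * (4 * 16 ^ k)) ^ n * p powr t"
    using cardT by (rule mult_right_mono) simp
  finally show ?thesis .
qed


section \<open>The first contraction\<close>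

lemma measure_bind_pmf_le:
  assumes "\<And>x. measure_pmf.prob (N x) X \<le> c"
  shows "measure_pmf.prob (bind_pmf M N) X \<le> c"
proof -
  have c: "0 \<le> c" using assms measure_nonneg order_trans by blast
  have "emeasure (bind_pmf M N) X \<le> (\<integral>\<^sup>+x. ennreal c \<partial>measure_pmf M)"
    unfolding emeasure_bind_pmf using assms
    by (intro nn_integral_mono) (simp add: measure_pmf.emeasure_eq_measure ennreal_leI)
  then show ?thesis
    using c by (simp add: measure_pmf.emeasure_eq_measure)
qed

text \<open>
The pairs at \<open>v\<close> are independent of all others. Once the others are fixed, the neighbourhood of
\<open>u\<close> outside \<open>v\<close> is a fixed set, and the vertices adjacent to exactly one of \<open>u\<close> and \<open>v\<close> are the
disagreements of \<open>n - 2\<close> independent indicators with it.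
\<close>
lemma prob_similar_neighbourhoods_le:
  fixes p \<epsilon> t :: real
  assumes uv: "u \<in> {1..n}" "v \<in> {1..n}" "u \<noteq> v"
    and p: "0 \<le> p" "p \<le> 1 / 2" and \<epsilon>: "0 \<le> \<epsilon>"
  shows "measure_pmf.prob (random_graph n p)
      {E. real (card {x \<in> {1..n} - {u, v}. ({u, x} \<in> E) \<noteq> ({v, x} \<in> E)}) \<le> t}
    \<le> exp (\<epsilon> * t - (\<epsilon> - \<epsilon>\<^sup>2 / 2) * p * (real n - 2))"
proof -
  let ?S = "{1..n} - {u, v}" and ?A = "all_pairs {1..n}"
  let ?P = "\<lambda>A. Pi_pmf A False (\<lambda>_. bernoulli_pmf p)"
  let ?T = "{f. real (card {x \<in> ?S. f {u, x} \<noteq> f {v, x}}) \<le> t}"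
  \<comment> \<open>\<open>C\<close> consists of the pairs at \<open>v\<close> still to be revealed, \<open>D\<close> of the pairs that are
    conditioned on.\<close>
  define C where "C = (\<lambda>x. {v, x}) ` ?S"
  define D where "D = ?A - C"
  have inj: "inj_on (\<lambda>x. {v, x}) ?S" by (auto simp: inj_on_def doubleton_eq_iff)
  have pairs: "{u, x} \<in> ?A" "{v, x} \<in> ?A" if "x \<in> ?S" for x
    using that uv by (auto simp: all_pairs_def)
  then have "C \<subseteq> ?A" unfolding C_def by blast
  then have A: "?A = D \<union> C" unfolding D_def by blast
  have uD: "{u, x} \<in> D" if "x \<in> ?S" for x
  proof -
    have "{u, x} \<noteq> {v, y}" for y using that uv(3) by (auto simp: doubleton_eq_iff)
    then show ?thesis using pairs(1)[OF that] unfolding D_def C_def by blast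
  qed
  have vD: "{v, x} \<notin> D" if "x \<in> ?S" for x
    using that unfolding D_def C_def by blast
  have "card ?S = n - 2" using uv by (simp add: card_Diff_subset)
  moreover have "2 \<le> n" using card_mono[of "{1..n}" "{u, v}"] uv by simp
  moreover have "card C = card ?S" unfolding C_def by (rule card_image[OF inj])
  ultimately have cardC: "real (card C) = real n - 2" by (simp only: of_nat_diff of_nat_numeral)
  have cond: "measure_pmf.prob (?P C) {f. (\<lambda>e. if e \<in> D then g e else f e) \<in> ?T}
      \<le> exp (\<epsilon> * t - (\<epsilon> - \<epsilon>\<^sup>2 / 2) * p * (real n - 2))" for g
  proof -
    \<comment> \<open>\<open>?g\<close> maps \<open>{v, x}\<close> to the value that \<open>g\<close> takes at \<open>{u, x}\<close>.\<close>
    let ?g = "\<lambda>e. g (insert u (e - {v}))"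
    have disagree: "card {e \<in> C. f e \<noteq> ?g e} = card {x \<in> ?S. g {u, x} \<noteq> f {v, x}}" for f
    proof -
      have single: "{v, x} - {v} = {x}" if "x \<in> ?S" for x using that by blast
      have "{e \<in> C. f e \<noteq> ?g e} = (\<lambda>x. {v, x}) ` {x \<in> ?S. f {v, x} \<noteq> ?g {v, x}}"
        unfolding C_def by blast
      also have "{x \<in> ?S. f {v, x} \<noteq> ?g {v, x}} = {x \<in> ?S. g {u, x} \<noteq> f {v, x}}"
        using single by (intro Collect_cong conj_cong refl) auto
      finally show ?thesis
        by (simp only:) (rule card_image, rule inj_on_subset[OF inj], blast)
    qed
    have glue: "{x \<in> ?S. (if {u, x} \<in> D then g {u, x} else f {u, x})
          \<noteq> (if {v, x} \<in> D then g {v, x} else f {v, x})}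
        = {x \<in> ?S. g {u, x} \<noteq> f {v, x}}" for f
      by (intro Collect_cong conj_cong refl) (simp only: uD vD if_True if_False)
    have "{f. (\<lambda>e. if e \<in> D then g e else f e) \<in> ?T}
        = {f. real (card {e \<in> C. f e \<noteq> ?g e}) \<le> t}"
      by (simp only: mem_Collect_eq glue disagree)
    moreover have "finite C" by (simp add: C_def)
    ultimately show ?thesis
      using prob_few_disagreements_le[of C p \<epsilon> ?g t] p \<epsilon> unfolding cardC by (simp only:)
  qed
  have "?P ?A = map_pmf (\<lambda>(g, f) e. if e \<in> D then g e else f e) (pair_pmf (?P D) (?P C))"
    unfolding A by (intro Pi_pmf_union) (auto simp: C_def D_def)
  also have "\<dots> = bind_pmf (?P D) (\<lambda>g. map_pmf (\<lambda>f e. if e \<in> D then g e else f e) (?P C))"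
    by (simp add: pair_pmf_def map_bind_pmf map_pmf_def[symmetric] bind_return_pmf)
       (simp add: map_pmf_def bind_assoc_pmf bind_return_pmf)
  finally have "measure_pmf.prob (?P ?A) ?T
      \<le> exp (\<epsilon> * t - (\<epsilon> - \<epsilon>\<^sup>2 / 2) * p * (real n - 2))"
    by (simp only:) (rule measure_bind_pmf_le, simp only: measure_map_pmf vimage_def cond)
  moreover have "(\<lambda>f. {e \<in> ?A. f e}) -` {E. real (card {x \<in> ?S. ({u, x} \<in> E) \<noteq> ({v, x} \<in> E)}) \<le> t} = ?T"
  proof -
    have "{x \<in> ?S. ({u, x} \<in> {e \<in> ?A. f e}) \<noteq> ({v, x} \<in> {e \<in> ?A. f e})}
        = {x \<in> ?S. f {u, x} \<noteq> f {v, x}}" for f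
      using pairs by (intro Collect_cong conj_cong refl) (simp only: mem_Collect_eq simp_thms)
    then show ?thesis by (simp only: vimage_def mem_Collect_eq)
  qed
  ultimately show ?thesis by (simp only: random_graph_def measure_map_pmf)
qed

text \<open>
There is no red edge in a graph, so the red neighbours after the first contraction are exactly the
vertices adjacent to one of the two contracted vertices but not to the other.
\<close>
lemma similar_pair_if_narrow:
  assumes nar: "narrow k (trigraph_of_graph V E)" and V: "2 \<le> card V"
  shows "\<exists>u\<in>V. \<exists>v\<in>V. u \<noteq> v \<and> card {x \<in> V - {u, v}. ({u, x} \<in> E) \<noteq> ({v, x} \<in> E)} \<le> k"
  using nar
proof cases
  case single
  then show ?thesis using V by (simp add: trigraph_of_graph_def)
next
  case (merge u v)
  let ?G = "trigraph_of_graph V E" and ?H = "contract u v u (trigraph_of_graph V E)"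
  have "red_degree ?H u \<le> k"
    using merge(3,5,6) by (intro narrow_red_degree) (auto simp: verts_contract)
  moreover have "{x. {u, x} \<in> red ?H} = {x \<in> V - {u, v}. ({u, x} \<in> E) \<noteq> ({v, x} \<in> E)}"
    unfolding red_contract_iff by (auto simp: trigraph_of_graph_def)
  ultimately have "card {x \<in> V - {u, v}. ({u, x} \<in> E) \<noteq> ({v, x} \<in> E)} \<le> k"
    using red_degree_eq_card_neighbours[OF narrow_is_trigraph[OF merge(6)], of u] by simp
  then show ?thesis
    using merge(3-5) unfolding trigraph_of_graph_def by auto
qed

lemma prob_narrow_le_similar_pair:
  fixes p \<epsilon> :: real
  assumes n: "2 \<le> n" and p: "0 \<le> p" "p \<le> 1 / 2" and \<epsilon>: "0 \<le> \<epsilon>"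
  shows "measure_pmf.prob (random_graph n p) {E. narrow k (trigraph_of_graph {1..n} E)}
    \<le> real n ^ 2 * exp (\<epsilon> * real k - (\<epsilon> - \<epsilon>\<^sup>2 / 2) * p * (real n - 2))"
proof -
  let ?W = "{(u, v) \<in> {1..n} \<times> {1..n}. u \<noteq> v}"
  let ?b = "exp (\<epsilon> * real k - (\<epsilon> - \<epsilon>\<^sup>2 / 2) * p * (real n - 2))"
  let ?T = "\<lambda>(u, v). {E. real (card {x \<in> {1..n} - {u, v}. ({u, x} \<in> E) \<noteq> ({v, x} \<in> E)}) \<le> real k}"
  have finW: "finite ?W" by (rule finite_subset[where B = "{1..n} \<times> {1..n}"]) auto
  have "card ?W \<le> card ({1..n} \<times> {1..n})" by (intro card_mono) auto
  then have cardW: "real (card ?W) \<le> real n ^ 2"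
    by (simp add: card_cartesian_product power2_eq_square flip: of_nat_mult)
  have "{E. narrow k (trigraph_of_graph {1..n} E)} \<subseteq> (\<Union>w\<in>?W. ?T w)"
    using similar_pair_if_narrow[of k "{1..n}"] n by fastforce
  then have "measure_pmf.prob (random_graph n p) {E. narrow k (trigraph_of_graph {1..n} E)}
      \<le> measure_pmf.prob (random_graph n p) (\<Union>w\<in>?W. ?T w)"
    by (intro measure_pmf.finite_measure_mono) auto
  also have "\<dots> \<le> (\<Sum>w\<in>?W. measure_pmf.prob (random_graph n p) (?T w))"
    by (intro measure_pmf.finite_measure_subadditive_finite finW) auto
  also have "\<dots> \<le> (\<Sum>w\<in>?W. ?b)"
  proof (rule sum_mono)
    fix w assume "w \<in> ?W"
    then obtain u v where w: "w = (u, v)" and uv: "u \<in> {1..n}" "v \<in> {1..n}" "u \<noteq> v" by blast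
    show "measure_pmf.prob (random_graph n p) (?T w) \<le> ?b"
      unfolding w prod.case by (rule prob_similar_neighbourhoods_le[OF uv p \<epsilon>])
  qed
  also have "\<dots> = real (card ?W) * ?b" by simp
  also have "\<dots> \<le> real n ^ 2 * ?b" using cardW by (rule mult_right_mono) simp
  finally show ?thesis .
qed


section \<open>The lower bound\<close>

lemma is_trigraph_of_graph:
  assumes "finite V" "E \<subseteq> all_pairs V"
  shows "is_trigraph (trigraph_of_graph V E)"
  using assms by (simp add: is_trigraph_def trigraph_of_graph_def)

lemma prob_tww_less_le:
  fixes r :: real
  assumes "1 \<le> n"
  shows "measure_pmf.prob (random_graph n p) {E. real (tww (trigraph_of_graph {1..n} E)) < r}
    \<le> measure_pmf.prob (random_graph n p) {E. narrow (nat \<lfloor>r\<rfloor>) (trigraph_of_graph {1..n} E)}"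
proof (rule measure_pmf.finite_measure_mono_AE)
  have "narrow (nat \<lfloor>r\<rfloor>) (trigraph_of_graph {1..n} E)"
    if "E \<in> set_pmf (random_graph n p)" "real (tww (trigraph_of_graph {1..n} E)) < r" for E
  proof (rule narrow_tww)
    show "is_trigraph (trigraph_of_graph {1..n} E)"
      using set_random_graph[OF that(1)] by (intro is_trigraph_of_graph) auto
    show "verts (trigraph_of_graph {1..n} E) \<noteq> {}" using assms by (simp add: trigraph_of_graph_def)
    show "tww (trigraph_of_graph {1..n} E) \<le> nat \<lfloor>r\<rfloor>" using that(2) by linarith
  qed
  then show "AE E in random_graph n p. E \<in> {E. real (tww (trigraph_of_graph {1..n} E)) < r} \<longrightarrow>
      E \<in> {E. narrow (nat \<lfloor>r\<rfloor>) (trigraph_of_graph {1..n} E)}"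
    by (simp add: AE_measure_pmf_iff)
qed auto

lemma real_choose_two: "real (n choose 2) = real n * (real n - 1) / 2"
  by (cases n) (simp_all add: choose_two real_of_nat_div algebra_simps)

text \<open>
With \<open>l = ln n\<close> and \<open>d = n p\<close>, the logarithm of the left-hand side is at most
\<open>n (2 l + 2 + 4 d - 3 / 8 * d l)\<close>, using \<open>ln 2 \<le> 1\<close>, \<open>ln p \<le> - 7 / 8 * l\<close> and
\<open>49 / 128 * (n - 1) \<ge> 3 / 8 * n\<close> for \<open>n \<ge> 49\<close>. Since \<open>d \<ge> 7\<close>, the term \<open>2 l\<close> is at most
\<open>2 / 7 * d l\<close>, which leaves \<open>- 5 / 56 * d l\<close> to absorb \<open>2 + 4 d\<close>; \<open>l \<ge> 68\<close> is enough for this.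
\<close>
lemma eventually_counting_bound:
  "\<forall>\<^sub>F n in sequentially. \<forall>p k. 7 \<le> real n * p \<and> p \<le> real n powr (- 7 / 8) \<and> real k \<le> real n * p \<longrightarrow>
     (real n ^ 2 * (4 * 16 ^ k)) ^ n * p powr (7 / 8 * p * real (n choose 2)) \<le> exp (- real n)"
proof -
  have "\<forall>\<^sub>F n in sequentially. 68 \<le> ln (real n)" by real_asymp
  moreover have "\<forall>\<^sub>F n in sequentially. 49 \<le> n" by (rule eventually_ge_at_top)
  ultimately show ?thesis
  proof (eventually_elim, intro allI impI)
    fix n :: nat and p :: real and k :: nat
    assume L: "68 \<le> ln (real n)" and n: "49 \<le> n"
      and A: "7 \<le> real n * p \<and> p \<le> real n powr (- 7 / 8) \<and> real k \<le> real n * p"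
    define d where "d = real n * p"
    define l where "l = ln (real n)"
    have d: "7 \<le> d" "real k \<le> d" using A by (simp_all add: d_def)
    have "0 < real n * p" using A by linarith
    then have p: "0 < p" using n by (simp add: zero_less_mult_iff)
    have "ln p \<le> ln (real n powr (- 7 / 8))" using A p n by (subst ln_le_cancel_iff) auto
    then have lnp: "ln p \<le> - (7 / 8) * l" using n by (simp add: l_def ln_powr)
    have ln2: "ln (2::real) \<le> 1" using ln_le_minus_one[of 2] by simp
    have "(real n ^ 2 * (4 * 16 ^ k)) = exp (2 * l + (2 * ln 2 + real k * (4 * ln 2)))"
    proof -
      have "exp (2 * l) = real n ^ 2"
        using n by (simp add: l_def exp_double)
      moreover have "exp (2 * ln 2) = (4::real)" by (simp add: exp_double)
      moreover have "exp (4 * ln 2) = (16::real)" using exp_of_nat_mult[of 4 "ln 2 :: real"] by simp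
      then have "exp (real k * (4 * ln 2)) = (16::real) ^ k" by (simp only: exp_of_nat_mult)
      ultimately show ?thesis by (simp only: exp_add)
    qed
    then have "(real n ^ 2 * (4 * 16 ^ k)) ^ n = exp (real n * (2 * l + (2 * ln 2 + real k * (4 * ln 2))))"
      by (simp only: exp_of_nat_mult)
    also have "\<dots> \<le> exp (real n * (2 * l + 2 + 4 * d))"
    proof -
      have "real k * (4 * ln 2) \<le> d * 4" using d ln2 by (intro mult_mono) auto
      then have "2 * l + (2 * ln 2 + real k * (4 * ln 2)) \<le> 2 * l + 2 + 4 * d" using ln2 by linarith
      then show ?thesis by (simp add: mult_left_mono)
    qed
    finally have count: "(real n ^ 2 * (4 * 16 ^ k)) ^ n \<le> exp (real n * (2 * l + 2 + 4 * d))" .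
    have "p * real (n choose 2) = d * (real n - 1) / 2"
      by (simp add: real_choose_two d_def)
    then have "p powr (7 / 8 * p * real (n choose 2)) = exp (7 / 16 * d * (real n - 1) * ln p)"
      using p by (simp add: powr_def mult.assoc)
    also have "\<dots> \<le> exp (7 / 16 * d * (real n - 1) * (- (7 / 8) * l))"
    proof -
      have "7 / 16 * d * (real n - 1) * ln p \<le> 7 / 16 * d * (real n - 1) * (- (7 / 8) * l)"
        using lnp d n by (intro mult_left_mono) auto
      then show ?thesis by (simp only: exp_le_cancel_iff)
    qed
    also have "\<dots> \<le> exp (- (3 / 8) * real n * d * l)"
    proof -
      have "(48 / 49 * real n) * (d * l) \<le> (real n - 1) * (d * l)"
        using n d L by (intro mult_right_mono) (auto simp: l_def)
      then show ?thesis by (simp add: algebra_simps)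
    qed
    finally have weight: "p powr (7 / 8 * p * real (n choose 2)) \<le> exp (- (3 / 8) * real n * d * l)" .
    have "(real n ^ 2 * (4 * 16 ^ k)) ^ n * p powr (7 / 8 * p * real (n choose 2))
        \<le> exp (real n * (2 * l + 2 + 4 * d)) * exp (- (3 / 8) * real n * d * l)"
      using count weight by (intro mult_mono) auto
    also have "\<dots> = exp (real n * (2 * l + 2 + 4 * d - 3 / 8 * (d * l)))"
      by (simp add: exp_add[symmetric] algebra_simps)
    also have "\<dots> \<le> exp (real n * (- 1))"
    proof -
      have "7 * l \<le> d * l" "68 * d \<le> d * l"
        using d L by (auto intro: mult_right_mono simp: l_def mult.commute)
      then have "2 * l + 2 + 4 * d - 3 / 8 * (d * l) \<le> - 1"
        using d(1) by linarith
      then have "real n * (2 * l + 2 + 4 * d - 3 / 8 * (d * l)) \<le> real n * (- 1)"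
        by (rule mult_left_mono) simp
      then show ?thesis by (simp only: exp_le_cancel_iff)
    qed
    finally show "(real n ^ 2 * (4 * 16 ^ k)) ^ n * p powr (7 / 8 * p * real (n choose 2)) \<le> exp (- real n)"
      by simp
  qed
qed

theorem proposition4p4:
  fixes p :: "nat \<Rightarrow> real" and \<delta> :: real
  assumes "\<And>n. n \<ge> 2 \<Longrightarrow> 1 / real n \<le> p n \<and> p n \<le> 1 / 2"
    and "0 < \<delta>" and "\<delta> < 4 / 7"
  shows "(\<lambda>n. measure_pmf.prob (random_graph n (p n))
            {E. real (tww (trigraph_of_graph {1..n} E))
                  \<ge> (1 - \<delta>) * real n * p n - 4 * (1 - \<delta>) / \<delta>})
          \<longlonglongrightarrow> 1"
proof -
  define r where "r n = (1 - \<delta>) * real n * p n - 4 * (1 - \<delta>) / \<delta>" for n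
  define b where "b n = exp (- real n) + exp (- 3 / 128 * (real n - 1))
      + real n ^ 2 * exp (- \<delta>\<^sup>2 / 2 * real n powr (1 / 8) + 1)" for n
  let ?good = "\<lambda>n. {E. real (tww (trigraph_of_graph {1..n} E)) \<ge> r n}"
  let ?bad = "\<lambda>n. {E. real (tww (trigraph_of_graph {1..n} E)) < r n}"
  let ?M = "\<lambda>n. random_graph n (p n)"
  have b: "b \<longlonglongrightarrow> 0"
    using \<open>0 < \<delta>\<close> unfolding b_def by real_asymp
  have "\<forall>\<^sub>F n in sequentially. 2 \<le> n" by (rule eventually_ge_at_top)
  then have bad: "\<forall>\<^sub>F n in sequentially. measure_pmf.prob (?M n) (?bad n) \<le> b n"
    using eventually_counting_bound
  proof eventually_elim
    case (elim n)
    have p: "0 < p n" "p n \<le> 1 / 2" 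
      using assms(1)[OF elim(1)] elim(1) by (auto intro: less_le_trans[of 0 "1 / real n"])
    define k where "k = nat \<lfloor>r n\<rfloor>"
    show ?case
    proof (cases "r n \<le> 0")
      case True
      then have "?bad n = {}" by (auto simp: not_less intro: order_trans)
      then show ?thesis by (simp add: b_def add_nonneg_nonneg)
    next
      case False
      have \<delta>: "0 < 1 - \<delta>" using assms(3) by simp
      have k: "real k \<le> r n" using False by (simp add: k_def)
      have "r n = (1 - \<delta>) * (real n * p n - 4 / \<delta>)" by (simp add: r_def algebra_simps)
      then have "4 / \<delta> < real n * p n" using False \<delta> by (simp add: not_le zero_less_mult_iff)
      moreover have "7 < 4 / \<delta>" using assms(2,3) by (simp add: field_simps)
      ultimately have np: "7 \<le> real n * p n" by simp
      have "r n \<le> (1 - \<delta>) * (real n * p n)" using assms(2) \<delta> by (simp add: r_def)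
      then have k1: "real k \<le> (1 - \<delta>) * (real n * p n)" using k by simp
      have "(1 - \<delta>) * (real n * p n) \<le> 1 * (real n * p n)"
        using assms(2) p by (intro mult_right_mono) auto
      then have k2: "real k \<le> real n * p n" using k1 by simp
      have bad_le: "measure_pmf.prob (?M n) (?bad n)
          \<le> measure_pmf.prob (?M n) {E. narrow k (trigraph_of_graph {1..n} E)}"
        unfolding k_def using elim(1) by (intro prob_tww_less_le) simp
      show ?thesis
      proof (cases "p n \<le> real n powr (- 7 / 8)")
        case True
        \<comment> \<open>Sparse case. The threshold \<open>?t\<close> is \<open>7 / 8\<close> of the expected number of edges.\<close>
        let ?t = "7 / 8 * p n * real (n choose 2)"
        let ?many = "{E. narrow k (trigraph_of_graph {1..n} E) \<and> ?t < real (card E)}"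
        let ?few = "{E. real (card E) \<le> ?t}"
        have many: "measure_pmf.prob (?M n) ?many \<le> exp (- real n)"
          using prob_narrow_many_edges_le[of "p n" n k ?t] p elim(2) np True k2 by fastforce
        have "measure_pmf.prob (?M n) ?few
            \<le> exp (1 / 8 * ?t - (1 / 8 - (1 / 8)\<^sup>2 / 2) * p n * real (n choose 2))"
          using p by (intro prob_few_edges_le) auto
        also have "\<dots> = exp (- (p n * real (n choose 2)) / 128)"
          by (simp add: power2_eq_square algebra_simps)
        also have "\<dots> \<le> exp (- 3 / 128 * (real n - 1))"
        proof -
          have "p n * real (n choose 2) = (real n * p n) * ((real n - 1) / 2)"
            by (simp add: real_choose_two)
          moreover have "7 * ((real n - 1) / 2) \<le> (real n * p n) * ((real n - 1) / 2)"
            using np elim(1) by (intro mult_right_mono) auto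
          moreover have "3 * (real n - 1) \<le> 7 * ((real n - 1) / 2)" using elim(1) by simp
          ultimately have "3 * (real n - 1) \<le> p n * real (n choose 2)" by linarith
          then show ?thesis by simp
        qed
        finally have few: "measure_pmf.prob (?M n) ?few \<le> exp (- 3 / 128 * (real n - 1))" .
        have "measure_pmf.prob (?M n) {E. narrow k (trigraph_of_graph {1..n} E)}
            \<le> measure_pmf.prob (?M n) (?many \<union> ?few)"
          by (intro measure_pmf.finite_measure_mono) auto
        also have "\<dots> \<le> measure_pmf.prob (?M n) ?many + measure_pmf.prob (?M n) ?few"
          by (intro measure_Un_le) auto
        finally have "measure_pmf.prob (?M n) (?bad n) \<le> exp (- real n) + exp (- 3 / 128 * (real n - 1))"
          using bad_le many few by linarith
        then show ?thesis unfolding b_def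
          by (rule order_trans) simp
      next
        case False
        \<comment> \<open>Dense case. The Chernoff parameter \<open>\<delta>\<close> makes the exponent \<open>- \<delta>\<^sup>2 / 2 * n p\<close>, up to a
          term of at most \<open>1\<close> that comes from the factor \<open>n - 2\<close> in place of \<open>n\<close>.\<close>
        have "measure_pmf.prob (?M n) {E. narrow k (trigraph_of_graph {1..n} E)}
            \<le> real n ^ 2 * exp (\<delta> * real k - (\<delta> - \<delta>\<^sup>2 / 2) * p n * (real n - 2))"
          using p elim(1) assms(2) by (intro prob_narrow_le_similar_pair) auto
        also have "\<dots> \<le> real n ^ 2 * exp (- \<delta>\<^sup>2 / 2 * real n powr (1 / 8) + 1)"
        proof -
          have "real n powr (1 / 8) = real n * real n powr (- 7 / 8)"
            using elim(1) powr_mult_base[of "real n" "- 7 / 8"] by simp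
          also have "\<dots> \<le> real n * p n" using False by (intro mult_left_mono) auto
          finally have "\<delta>\<^sup>2 / 2 * real n powr (1 / 8) \<le> \<delta>\<^sup>2 / 2 * (real n * p n)"
            by (rule mult_left_mono) simp
          moreover have "\<delta> * real k \<le> \<delta> * ((1 - \<delta>) * (real n * p n))"
            using k1 assms(2) by (intro mult_left_mono) auto
          moreover have "\<delta> * ((1 - \<delta>) * (real n * p n)) - (\<delta> - \<delta>\<^sup>2 / 2) * p n * (real n - 2)
              = - (\<delta>\<^sup>2 / 2 * (real n * p n)) + (2 * \<delta> - \<delta>\<^sup>2) * p n"
            by (simp add: field_simps power2_eq_square)
          moreover have "(2 * \<delta> - \<delta>\<^sup>2) * p n \<le> 2 * (1 / 2)"
          proof (rule mult_mono)
            show "2 * \<delta> - \<delta>\<^sup>2 \<le> 2" using assms(3) zero_le_power2[of \<delta>] by linarith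
          qed (use p in auto)
          ultimately show ?thesis by (intro mult_left_mono) auto
        qed
        finally have "measure_pmf.prob (?M n) (?bad n)
            \<le> real n ^ 2 * exp (- \<delta>\<^sup>2 / 2 * real n powr (1 / 8) + 1)"
          using bad_le by linarith
        then show ?thesis unfolding b_def
          by (rule order_trans) simp
      qed
    qed
  qed
  have good: "measure_pmf.prob (?M n) (?good n) = 1 - measure_pmf.prob (?M n) (?bad n)" for n
  proof -
    have "?good n = UNIV - ?bad n" by auto
    then show ?thesis using measure_pmf.prob_compl[of "?bad n" "?M n"] by simp
  qed
  have "(\<lambda>n. measure_pmf.prob (?M n) (?bad n)) \<longlonglongrightarrow> 0"
    by (rule tendsto_sandwich[OF _ bad tendsto_const b]) simp
  then have "(\<lambda>n. 1 - measure_pmf.prob (?M n) (?bad n)) \<longlonglongrightarrow> 1 - 0"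
    by (intro tendsto_diff tendsto_const)
  then have "(\<lambda>n. measure_pmf.prob (?M n) (?good n)) \<longlonglongrightarrow> 1"
    by (simp only: good diff_zero)
  then show ?thesis unfolding r_def .
qed

end
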